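(* Consider the SVRG method with the discrepancy principle (defined in the context). If $\tau>1$, $\gamma_0>0$ and $\gamma_1>0$ are chosen such that $0<\gamma_1<1/L$ and $$c_1:=2\gamma_0-\frac{2\gamma_0}{\tau}-\gamma_0^2\|A\|^2-\frac{2m\gamma_1^2L}{N}-\frac{m\gamma_1}{2N(1-\gamma_1L)\tau^2}>0,$$ then $$\mathbb{E}\left[\|x_{n+1}^\delta-x^\dagger\|^2\right]\le\mathbb{E}\left[\|x_n^\delta-x^\dagger\|^2\right]-c_1\,\mathbb{E}\left[\mu_n\|Ax_n^\delta-y^\delta\|^2\right]$$ for all integers $n\ge0$. Moreover, the method must terminate in finitely many steps almost surely, i.e. with probability one there is a finite integer $n\ge0$ such that $\|Ax_n^\delta-y^\delta\|\le\tau\delta$.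
   Context: Setting. $X$ and $Y_1,\dots,Y_N$ are Hilbert spaces, $A_i:X\to Y_i$ are bounded linear operators, $Y=Y_1\times\cdots\times Y_N$ with the natural product inner product, and $Ax=(A_1x,\dots,A_Nx)$, so $A^*z=\sum_{i=1}^N A_i^*z_i$. $L:=\max\{\|A_i\|^2: i=1,\dots,N\}$. The exact data $y=(y_1,\dots,y_N)$ lies in $\mathrm{Ran}(A)$. Given $x_0\in X$, $x^\dagger$ is the unique $x_0$-minimal norm solution, i.e. the solution of $Ax=y$ minimizing $\|x-x_0\|$. Noisy data $y^\delta\in Y$ satisfy $\|y^\delta-y\|\le\delta$, where $\delta>0$. SVRG with the discrepancy principle. Given an integer $m\ge1$, $x_0\in X$, $\tau>1$ and $\gamma_0,\gamma_1>0$, let $i_{n,k}$ ($n\ge0$, $0\le k\le m-1$) be independent random indices uniformly distributed on $\{1,\dots,N\}$. Set $x_0^\delta=x_0$, and for $n=0,1,\dots$: $r_n^\delta=Ax_n^\delta-y^\delta$; $\mu_n=1$ if $\|r_n^\delta\|>\tau\delta$ and $\mu_n=0$ if $\|r_n^\delta\|\le\tau\delta$; $g_n^\delta=A^*r_n^\delta$; $x_{n,0}^\delta=x_n^\delta-\gamma_0\mu_ng_n^\delta$; for $k=0,\dots,m-1$, $$x_{n,k+1}^\delta=x_{n,k}^\delta-\gamma_1\mu_n\left(A_{i_{n,k}}^*A_{i_{n,k}}(x_{n,k}^\delta-x_n^\delta)+\tfrac1N g_n^\delta\right);$$ and $x_{n+1}^\delta=x_{n,m}^\delta$. $\mathbb{E}$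 and "almost surely" refer to the randomness of the indices. *)

theory Defs
  imports "HOL-Probability.Probability"
begin

text \<open>
  Hilbert spaces are types of sort \<open>{real_inner, complete_space}\<close>.  The spaces \<open>Y\<^sub>i\<close>, indexed by a
  finite type \<open>'n\<close> with \<open>N = CARD('n)\<close>, may differ, so they are closed subspaces of a common Hilbert
  space \<open>'y\<close> (any finite family embeds isometrically into its direct sum); their product is a closed
  subspace of \<open>'y ^ 'n\<close>, whose inner product is the sum of the componentwise ones.  Since the range
  of \<open>A i\<close> lies in \<open>Y\<^sub>i\<close>, the adjoint of \<open>A i\<close> taken with respect to \<open>'y\<close> extends the one taken with
  respect to \<open>Y\<^sub>i\<close>, and it is only ever applied to elements of \<open>Y\<^sub>i\<close>.
\<close>

definition stacked :: "('n::finite \<Rightarrow> 'x \<Rightarrow> 'y) \<Rightarrow> 'x \<Rightarrow> 'y ^ 'n"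
  where "stacked A x = (\<chi> i. A i x)"

definition discr_mu :: "('n::finite \<Rightarrow> 'x \<Rightarrow> 'y::real_inner) \<Rightarrow> 'y ^ 'n \<Rightarrow> real \<Rightarrow> real \<Rightarrow> 'x \<Rightarrow> real"
  where "discr_mu A yd \<tau> \<delta> x = (if norm (stacked A x - yd) > \<tau> * \<delta> then 1 else 0)"

definition full_grad :: "('n::finite \<Rightarrow> 'x::real_inner \<Rightarrow> 'y::real_inner) \<Rightarrow> 'y ^ 'n \<Rightarrow> 'x \<Rightarrow> 'x"
  where "full_grad A yd x = adjoint (stacked A) (stacked A x - yd)"

text \<open>
  \<open>svrg_inner A yd \<tau> \<delta> \<gamma>0 \<gamma>1 x j k\<close> is the inner iterate \<open>x\<^bsub>n,k\<^esub>\<close> when \<open>x = x\<^sub>n\<close> is the snapshot point and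
  \<open>j k\<close> is the index drawn in inner step \<open>k\<close>.
\<close>

primrec svrg_inner ::
  "('n::finite \<Rightarrow> 'x::real_inner \<Rightarrow> 'y::real_inner) \<Rightarrow> 'y ^ 'n \<Rightarrow> real \<Rightarrow> real \<Rightarrow> real \<Rightarrow> real \<Rightarrow>
    'x \<Rightarrow> (nat \<Rightarrow> 'n) \<Rightarrow> nat \<Rightarrow> 'x"
  where
    "svrg_inner A yd \<tau> \<delta> \<gamma>0 \<gamma>1 x j 0 =
       x - (\<gamma>0 * discr_mu A yd \<tau> \<delta> x) *\<^sub>R full_grad A yd x"
  | "svrg_inner A yd \<tau> \<delta> \<gamma>0 \<gamma>1 x j (Suc k) =
       svrg_inner A yd \<tau> \<delta> \<gamma>0 \<gamma>1 x j k
       - (\<gamma>1 * discr_mu A yd \<tau> \<delta> x) *\<^sub>R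
           (adjoint (A (j k)) (A (j k) (svrg_inner A yd \<tau> \<delta> \<gamma>0 \<gamma>1 x j k - x))
            + (1 / real CARD('n)) *\<^sub>R full_grad A yd x)"

primrec svrg ::
  "('n::finite \<Rightarrow> 'x::real_inner \<Rightarrow> 'y::real_inner) \<Rightarrow> 'y ^ 'n \<Rightarrow> real \<Rightarrow> real \<Rightarrow> real \<Rightarrow> real \<Rightarrow>
    nat \<Rightarrow> 'x \<Rightarrow> (nat \<Rightarrow> nat \<Rightarrow> 'n) \<Rightarrow> nat \<Rightarrow> 'x"
  where
    "svrg A yd \<tau> \<delta> \<gamma>0 \<gamma>1 m x0 j 0 = x0"
  | "svrg A yd \<tau> \<delta> \<gamma>0 \<gamma>1 m x0 j (Suc n) =
       svrg_inner A yd \<tau> \<delta> \<gamma>0 \<gamma>1 (svrg A yd \<tau> \<delta> \<gamma>0 \<gamma>1 m x0 j n) (j n) m"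

end

theory Submission
  imports Defs
begin

text \<open>
  Let \<open>r\<close> be the residual at the snapshot \<open>x\<^sub>n\<close> and suppose that \<open>\<tau> \<delta> < \<parallel>r\<parallel>\<close>. The full gradient step
  lowers the squared error by at least
  \<open>(2 \<gamma>\<^sub>0 - 2 \<gamma>\<^sub>0 / \<tau> - \<gamma>\<^sub>0\<^sup>2 \<parallel>A\<parallel>\<^sup>2) \<parallel>r\<parallel>\<^sup>2\<close>. Let \<open>q\<close> be the residual at an inner iterate. Averaged over
  the fresh index, an inner step has drift at least \<open>(\<parallel>q\<parallel>\<^sup>2 - \<delta> \<parallel>q\<parallel>) / N\<close> towards the solution, and the
  second moment of its direction is at most \<open>(2 L / N) (\<parallel>q\<parallel>\<^sup>2 + \<parallel>r\<parallel>\<^sup>2)\<close>. Since \<open>\<gamma>\<^sub>1 L < 1\<close>, completing the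
  square in \<open>\<parallel>q\<parallel>\<close> leaves an increase of at most
  \<open>2 \<gamma>\<^sub>1\<^sup>2 L \<parallel>r\<parallel>\<^sup>2 / N + \<gamma>\<^sub>1 \<delta>\<^sup>2 / (2 N (1 - \<gamma>\<^sub>1 L))\<close>, and \<open>\<delta> \<le> \<parallel>r\<parallel> / \<tau>\<close>. Independence turns the
  average over the index into an expectation, because the iterates are functions of the finitely many
  earlier indices.
\<close>

section \<open>Riesz representation and the adjoint of a bounded operator\<close>

text \<open>The functional \<open>J x = (norm x)^2 - 2 * f x\<close> is bounded below; completeness
  yields a minimiser \<open>r\<close>, and the first-order condition at \<open>r\<close> is the
  representation.\<close>

lemma riesz_representation:
  fixes f :: "'a::{real_inner, complete_space} \<Rightarrow> real"
  assumes "bounded_linear f"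
  shows "\<exists>r. \<forall>x. f x = x \<bullet> r"
proof -
  interpret f: bounded_linear f by fact
  define J where "J x = (norm x)\<^sup>2 - 2 * f x" for x
  define I where "I = Inf (range J)"
  obtain K where K: "\<bar>f x\<bar> \<le> norm x * K" for x
    using f.bounded by auto
  have "- K\<^sup>2 \<le> J x" for x
  proof -
    have "0 \<le> (norm x - K)\<^sup>2" by simp
    then show ?thesis
      using K[of x] by (simp add: J_def power2_eq_square algebra_simps)
  qed
  then have "bdd_below (range J)" by (auto intro!: bdd_belowI)
  then have I_le: "I \<le> J x" for x
    unfolding I_def by (simp add: cINF_lower)
  have "\<exists>x. J x < I + inverse (real (Suc n))" for n
  proof -
    have "I < I + inverse (real (Suc n))" by simp
    then show ?thesis
      unfolding I_def using cInf_lessD[of "range J"] by fastforce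
  qed
  then obtain X where X: "J (X n) < I + inverse (real (Suc n))" for n
    by metis
  \<comment> \<open>Parallelogram law: the linear parts cancel against the midpoint, where
    \<open>J\<close> is at least \<open>I\<close>. Hence minimising sequences are Cauchy.\<close>
  have dist: "(norm (a - b))\<^sup>2 \<le> 2 * (J a - I) + 2 * (J b - I)" for a b
  proof -
    have "(norm (a - b))\<^sup>2 = 2 * J a + 2 * J b - 4 * J ((1/2) *\<^sub>R (a + b))"
      unfolding J_def
      by (simp add: power2_norm_eq_inner f.add f.scaleR inner_diff_left inner_diff_right
          inner_add_left inner_add_right inner_commute algebra_simps)
    then show ?thesis using I_le[of "(1/2) *\<^sub>R (a + b)"] by simp
  qed
  have "Cauchy X"
  proof (rule metric_CauchyI)
    fix e :: real assume "0 < e"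
    then obtain n where n: "inverse (real (Suc n)) < e\<^sup>2 / 4"
      using reals_Archimedean[of "e\<^sup>2 / 4"] by auto
    have "dist (X p) (X q) < e" if "p \<ge> n" "q \<ge> n" for p q
    proof -
      have "inverse (real (Suc p)) \<le> inverse (real (Suc n))"
        "inverse (real (Suc q)) \<le> inverse (real (Suc n))"
        using that by auto
      then have "J (X p) - I < e\<^sup>2 / 4" "J (X q) - I < e\<^sup>2 / 4"
        using X[of p] X[of q] n by (auto simp only: diff_less_eq)
      then have "(norm (X p - X q))\<^sup>2 < e\<^sup>2"
        using dist[of "X p" "X q"] by (simp add: field_simps)
      then show ?thesis
        using \<open>0 < e\<close> by (simp add: dist_norm power_less_imp_less_base)
    qed
    then show "\<exists>n. \<forall>p\<ge>n. \<forall>q\<ge>n. dist (X p) (X q) < e" by blast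
  qed
  then obtain r where r: "X \<longlonglongrightarrow> r"
    using Cauchy_convergent convergent_def by blast
  have "(\<lambda>n. J (X n)) \<longlonglongrightarrow> J r"
    unfolding J_def by (intro tendsto_intros f.tendsto r)
  moreover have "(\<lambda>n. I + inverse (real (Suc n))) \<longlonglongrightarrow> I + 0"
    by (intro tendsto_intros LIMSEQ_inverse_real_of_nat)
  ultimately have "J r \<le> I + 0"
    using X by (intro LIMSEQ_le) (auto intro: less_imp_le)
  then have min: "J r \<le> J x" for x using I_le[of x] by simp
  have "f x = x \<bullet> r" for x
  proof (cases "x = 0")
    case False
    define s where "s = x \<bullet> r - f x"
    \<comment> \<open>The minimiser of the quadratic \<open>2 * t * s + t^2 * (norm x)^2\<close> in
      \<open>t\<close>; its value there is negative unless \<open>s = 0\<close>.\<close>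
    define t where "t = - s / (norm x)\<^sup>2"
    have "J (r + t *\<^sub>R x) = J r + 2 * t * s + t\<^sup>2 * (norm x)\<^sup>2"
      unfolding J_def s_def power2_norm_eq_inner
      by (simp add: f.add f.scaleR inner_add_left inner_add_right
          inner_commute algebra_simps power2_eq_square)
    then have "0 \<le> 2 * t * s + t\<^sup>2 * (norm x)\<^sup>2" using min[of "r + t *\<^sub>R x"] by simp
    also have "\<dots> = - s\<^sup>2 / (norm x)\<^sup>2"
      using False by (simp add: t_def power2_eq_square field_simps)
    finally have "s\<^sup>2 / (norm x)\<^sup>2 \<le> 0" by simp
    then have "s = 0" using False
      by (simp add: divide_le_0_iff)
    then show ?thesis by (simp add: s_def)
  qed (simp add: f.zero)
  then show ?thesis by blast
qed

text \<open>\<open>adjoint\<close> is defined by choice, so its characteristic equation requires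
  that some adjoint exist; Riesz, applied for each \<open>y\<close> to the functional pairing
  \<open>f x\<close> with \<open>y\<close>, supplies one.\<close>

lemma inner_adjoint:
  fixes f :: "'a::{real_inner, complete_space} \<Rightarrow> 'b::real_inner"
  assumes "bounded_linear f"
  shows "f x \<bullet> y = x \<bullet> adjoint f y"
proof -
  have "\<exists>r. \<forall>x. f x \<bullet> y = x \<bullet> r" for y
    by (intro riesz_representation bounded_linear_compose[OF bounded_linear_inner_left assms])
  then obtain g where g: "\<forall>x y. f x \<bullet> y = x \<bullet> g y" by metis
  then show ?thesis using adjoint_unique[OF g] by simp
qed

lemma linear_adjoint:
  fixes f :: "'a::{real_inner, complete_space} \<Rightarrow> 'b::real_inner"
  assumes "bounded_linear f"
  shows "linear (adjoint f)"
proof (rule linearI)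
  note inner_adjoint[OF assms, symmetric, simp]
  show "adjoint f (a + b) = adjoint f a + adjoint f b" for a b
    by (rule vector_eq_ldot[THEN iffD1]) (simp add: inner_add_right)
  show "adjoint f (c *\<^sub>R a) = c *\<^sub>R adjoint f a" for c a
    by (rule vector_eq_ldot[THEN iffD1]) simp
qed

lemma norm_adjoint_le:
  fixes f :: "'a::{real_inner, complete_space} \<Rightarrow> 'b::real_inner"
  assumes "bounded_linear f"
  shows "norm (adjoint f y) \<le> onorm f * norm y"
proof (cases "adjoint f y = 0")
  case True
  then show ?thesis by (simp add: onorm_pos_le[OF assms])
next
  case False
  have "norm (adjoint f y) * norm (adjoint f y) = f (adjoint f y) \<bullet> y"
    by (simp add: inner_adjoint[OF assms] power2_norm_eq_inner flip: power2_eq_square)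
  also have "\<dots> \<le> norm (f (adjoint f y)) * norm y" by (rule norm_cauchy_schwarz)
  also have "\<dots> \<le> onorm f * norm (adjoint f y) * norm y"
    by (intro mult_right_mono onorm[OF assms]) simp
  finally show ?thesis using False by (simp add: mult.assoc mult.left_commute)
qed

lemma norm_adjoint_square_le:
  fixes f :: "'a::{real_inner, complete_space} \<Rightarrow> 'b::real_inner"
  assumes "bounded_linear f" "(onorm f)\<^sup>2 \<le> L"
  shows "(norm (adjoint f y))\<^sup>2 \<le> L * (norm y)\<^sup>2"
proof -
  have "(norm (adjoint f y))\<^sup>2 \<le> (onorm f)\<^sup>2 * (norm y)\<^sup>2"
    using power_mono[OF norm_adjoint_le[OF assms(1), of y], of 2] by (simp add: power_mult_distrib)
  also have "\<dots> \<le> L * (norm y)\<^sup>2" using assms(2) by (intro mult_right_mono) auto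
  finally show ?thesis .
qed

section \<open>The stacked operator and deterministic one-step estimates\<close>

lemma norm_diff_scaled_square:
  fixes u v z :: "'a::real_inner"
  shows "(norm (u - c *\<^sub>R v - z))\<^sup>2 = (norm (u - z))\<^sup>2 - 2 * c * (v \<bullet> (u - z)) + c\<^sup>2 * (norm v)\<^sup>2"
  unfolding power2_norm_eq_inner
  by (simp add: inner_diff_left inner_diff_right inner_commute power2_eq_square algebra_simps)

lemma norm_vec_square: "(norm (v :: 'y::real_inner ^ 'n::finite))\<^sup>2 = (\<Sum>i\<in>UNIV. (norm (v $ i))\<^sup>2)"
  by (simp add: power2_norm_eq_inner inner_vec_def)

lemma bounded_linear_stacked:
  fixes A :: "'n::finite \<Rightarrow> 'x::real_normed_vector \<Rightarrow> 'y::real_inner"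
  assumes A: "\<And>i. bounded_linear (A i)"
  shows "bounded_linear (stacked A)"
proof (rule bounded_linear_intro)
  show "stacked A (u + v) = stacked A u + stacked A v" for u v
    using A by (simp add: stacked_def vec_eq_iff linear_add bounded_linear.linear)
  show "stacked A (c *\<^sub>R u) = c *\<^sub>R stacked A u" for c u
    using A by (simp add: stacked_def vec_eq_iff linear_scale bounded_linear.linear)
  show "norm (stacked A u) \<le> norm u * (\<Sum>i\<in>UNIV. onorm (A i))" for u
  proof -
    have "norm (stacked A u) \<le> (\<Sum>i\<in>UNIV. norm (A i u))"
      unfolding norm_vec_def stacked_def by (simp add: L2_set_le_sum)
    also have "\<dots> \<le> (\<Sum>i\<in>UNIV. onorm (A i) * norm u)"
      by (intro sum_mono onorm A)
    finally show ?thesis by (simp add: sum_distrib_left mult.commute)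
  qed
qed

lemma adjoint_stacked:
  fixes A :: "'n::finite \<Rightarrow> 'x::{real_inner, complete_space} \<Rightarrow> 'y::real_inner"
  assumes A: "\<And>i. bounded_linear (A i)"
  shows "adjoint (stacked A) = (\<lambda>v. \<Sum>i\<in>UNIV. adjoint (A i) (v $ i))"
  by (rule adjoint_unique)
    (simp add: stacked_def inner_vec_def inner_adjoint[OF A] inner_sum_right)

text \<open>With \<open>q\<close> and \<open>r\<close> the residuals at \<open>u\<close> and \<open>x\<close>, the direction is
  \<open>v i = A\<^sub>i\<^sup>* q\<^sub>i - (s i - mean s)\<close> for \<open>s i = A\<^sub>i\<^sup>* r\<^sub>i\<close>; a variance is bounded by the second moment.\<close>

lemma svrg_direction_second_moment:
  fixes A :: "'n::finite \<Rightarrow> 'x::{real_inner, complete_space} \<Rightarrow> 'y::real_inner"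
  assumes A: "\<And>i. bounded_linear (A i)" and L: "\<And>i. (onorm (A i))\<^sup>2 \<le> L"
  shows "(\<Sum>i\<in>UNIV. (norm (adjoint (A i) (A i (u - x)) + (1 / real CARD('n)) *\<^sub>R full_grad A yd x))\<^sup>2)
    \<le> 2 * L * (norm (stacked A u - yd))\<^sup>2 + 2 * L * (norm (stacked A x - yd))\<^sup>2"
proof -
  define q r where "q = stacked A u - yd" and "r = stacked A x - yd"
  define w s where "w i = adjoint (A i) (q $ i)" and "s i = adjoint (A i) (r $ i)" for i
  define c where "c = (1 / real CARD('n)) *\<^sub>R (\<Sum>i\<in>UNIV. s i)"
  have c: "(1 / real CARD('n)) *\<^sub>R full_grad A yd x = c"
    by (simp add: full_grad_def adjoint_stacked[OF A] c_def s_def r_def)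
  have sum_s: "(\<Sum>i\<in>UNIV. s i) = real CARD('n) *\<^sub>R c" by (simp add: c_def)
  have direction: "adjoint (A i) (A i (u - x)) + c = w i - (s i - c)" for i
  proof -
    have "A i (u - x) = q $ i - r $ i"
      using A[of i] by (simp add: q_def r_def stacked_def linear_diff bounded_linear.linear)
    then show ?thesis
      by (simp add: w_def s_def linear_diff[OF linear_adjoint[OF A]])
  qed
  have two: "(norm (a - b))\<^sup>2 \<le> 2 * (norm a)\<^sup>2 + 2 * (norm b)\<^sup>2" for a b :: 'x
  proof -
    have "(norm (a - b))\<^sup>2 = 2 * (norm a)\<^sup>2 + 2 * (norm b)\<^sup>2 - (norm (a + b))\<^sup>2"
      by (simp add: power2_norm_eq_inner inner_diff_left inner_diff_right inner_add_left
          inner_add_right inner_commute)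
    then show ?thesis by simp
  qed
  have "(\<Sum>i\<in>UNIV. (norm (s i - c))\<^sup>2)
      = (\<Sum>i\<in>UNIV. (norm (s i))\<^sup>2) - 2 * ((\<Sum>i\<in>UNIV. s i) \<bullet> c) + real CARD('n) * (norm c)\<^sup>2"
    by (simp add: power2_norm_eq_inner inner_diff_left inner_diff_right inner_commute
        algebra_simps sum.distrib sum_subtractf sum_distrib_left inner_sum_left inner_sum_right)
  \<comment> \<open>As \<open>c\<close> is the mean of the \<open>s i\<close>, the cross term is
    minus twice the last term.\<close>
  also have "\<dots> = (\<Sum>i\<in>UNIV. (norm (s i))\<^sup>2) - real CARD('n) * (norm c)\<^sup>2"
    by (simp add: sum_s power2_norm_eq_inner)
  finally have variance: "(\<Sum>i\<in>UNIV. (norm (s i - c))\<^sup>2) \<le> (\<Sum>i\<in>UNIV. (norm (s i))\<^sup>2)"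
    by simp
  have bound: "(\<Sum>i\<in>UNIV. (norm (adjoint (A i) (v $ i)))\<^sup>2) \<le> L * (norm v)\<^sup>2" for v
    unfolding norm_vec_square sum_distrib_left
    by (intro sum_mono norm_adjoint_square_le A L)
  have "(\<Sum>i\<in>UNIV. (norm (w i - (s i - c)))\<^sup>2)
      \<le> (\<Sum>i\<in>UNIV. 2 * (norm (w i))\<^sup>2 + 2 * (norm (s i - c))\<^sup>2)"
    by (intro sum_mono two)
  also have "\<dots> = 2 * (\<Sum>i\<in>UNIV. (norm (w i))\<^sup>2) + 2 * (\<Sum>i\<in>UNIV. (norm (s i - c))\<^sup>2)"
    by (simp add: sum.distrib sum_distrib_left)
  also have "\<dots> \<le> 2 * (L * (norm q)\<^sup>2) + 2 * (L * (norm r)\<^sup>2)"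
    using variance bound[of q] bound[of r] unfolding w_def s_def by linarith
  finally show ?thesis by (simp add: c direction q_def r_def)
qed

text \<open>The sum over all indices is \<open>CARD('n)\<close> times the mean over a uniform index,
  so no randomness enters here. The residual at \<open>u\<close> may be small compared with
  \<delta>; the noise therefore stays as an additive term in \<open>\<delta>^2\<close>.\<close>

lemma svrg_inner_step_average:
  fixes A :: "'n::finite \<Rightarrow> 'x::{real_inner, complete_space} \<Rightarrow> 'y::real_inner"
  assumes A: "\<And>i. bounded_linear (A i)" and L: "\<And>i. (onorm (A i))\<^sup>2 \<le> L"
    and yd: "norm (yd - stacked A z) \<le> \<delta>"
    and \<gamma>: "0 < \<gamma>" "\<gamma> * L < 1"
  shows "(\<Sum>i\<in>UNIV. (norm (u - \<gamma> *\<^sub>R (adjoint (A i) (A i (u - x))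
              + (1 / real CARD('n)) *\<^sub>R full_grad A yd x) - z))\<^sup>2)
    \<le> real CARD('n) * (norm (u - z))\<^sup>2 + 2 * \<gamma>\<^sup>2 * L * (norm (stacked A x - yd))\<^sup>2
       + \<gamma> * \<delta>\<^sup>2 / (2 * (1 - \<gamma> * L))"
proof -
  note S = bounded_linear_stacked[of A, OF A]
  define v where "v i = adjoint (A i) (A i (u - x)) + (1 / real CARD('n)) *\<^sub>R full_grad A yd x" for i
  define q r where "q = stacked A u - yd" and "r = stacked A x - yd"
  \<comment> \<open>The correction makes the direction unbiased: the snapshot residual cancels, and
    the directions sum to the full gradient at \<open>u\<close>.\<close>
  have "(\<Sum>i\<in>UNIV. v i) = adjoint (stacked A) (stacked A (u - x)) + adjoint (stacked A) r"
    by (simp add: v_def sum.distrib sum_constant_scaleR adjoint_stacked[OF A] full_grad_def r_def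
        stacked_def del: sum_constant)
  also have "\<dots> = adjoint (stacked A) q"
    by (simp add: q_def r_def linear_diff[OF bounded_linear.linear[OF S]]
        linear_diff[OF linear_adjoint[OF S]])
  finally have "(\<Sum>i\<in>UNIV. v i) \<bullet> (u - z) = q \<bullet> stacked A (u - z)"
    using inner_adjoint[OF S, of "u - z" q] by (simp add: inner_commute)
  \<comment> \<open>The image of the error is the residual plus the data noise; by Cauchy-Schwarz
    the noise costs at most \<open>\<delta> * norm q\<close>.\<close>
  also have "stacked A (u - z) = q + (yd - stacked A z)"
    by (simp add: q_def linear_diff[OF bounded_linear.linear[OF S]])
  also have "q \<bullet> (q + (yd - stacked A z)) \<ge> (norm q)\<^sup>2 - \<delta> * norm q"
  proof -
    have "- (q \<bullet> (yd - stacked A z)) \<le> norm q * norm (yd - stacked A z)"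
      using Cauchy_Schwarz_ineq2[of q "yd - stacked A z"] by linarith
    also have "\<dots> \<le> norm q * \<delta>" using yd by (intro mult_left_mono) auto
    finally show ?thesis by (simp add: inner_add_right power2_norm_eq_inner mult.commute)
  qed
  finally have drift: "(norm q)\<^sup>2 - \<delta> * norm q \<le> (\<Sum>i\<in>UNIV. v i) \<bullet> (u - z)" .
  have second: "(\<Sum>i\<in>UNIV. (norm (v i))\<^sup>2) \<le> 2 * L * (norm q)\<^sup>2 + 2 * L * (norm r)\<^sup>2"
    unfolding v_def q_def r_def by (rule svrg_direction_second_moment[OF A L])
  have square: "- 2 * \<gamma> * (1 - \<gamma> * L) * (norm q)\<^sup>2 + 2 * \<gamma> * \<delta> * norm q
      \<le> \<gamma> * \<delta>\<^sup>2 / (2 * (1 - \<gamma> * L))"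
  proof -
    define a where "a = 1 - \<gamma> * L"
    have "a > 0" using \<gamma> by (simp add: a_def)
    \<comment> \<open>The right-hand side is the maximum of the quadratic in \<open>norm q\<close>,
      attained at \<open>\<delta> / (2 * a)\<close>; the gap is a perfect square.\<close>
    then have "\<gamma> * \<delta>\<^sup>2 / (2 * a) - (- 2 * \<gamma> * a * (norm q)\<^sup>2 + 2 * \<gamma> * \<delta> * norm q)
        = \<gamma> / (2 * a) * (\<delta> - 2 * a * norm q)\<^sup>2"
      by (simp add: power2_eq_square field_simps)
    also have "\<dots> \<ge> 0" using \<open>a > 0\<close> \<gamma> by simp
    finally show ?thesis by (simp add: a_def)
  qed
  have "(\<Sum>i\<in>UNIV. (norm (u - \<gamma> *\<^sub>R v i - z))\<^sup>2)
      = real CARD('n) * (norm (u - z))\<^sup>2 - 2 * \<gamma> * ((\<Sum>i\<in>UNIV. v i) \<bullet> (u - z))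
        + \<gamma>\<^sup>2 * (\<Sum>i\<in>UNIV. (norm (v i))\<^sup>2)"
  proof -
    have "(norm (u - \<gamma> *\<^sub>R v i - z))\<^sup>2
        = (norm (u - z))\<^sup>2 - 2 * \<gamma> * (v i \<bullet> (u - z)) + \<gamma>\<^sup>2 * (norm (v i))\<^sup>2" for i
      by (rule norm_diff_scaled_square)
    then show ?thesis
      by (simp add: sum.distrib sum_subtractf sum_distrib_left inner_sum_left)
  qed
  also have "\<dots> \<le> real CARD('n) * (norm (u - z))\<^sup>2 - 2 * \<gamma> * ((norm q)\<^sup>2 - \<delta> * norm q)
        + \<gamma>\<^sup>2 * (2 * L * (norm q)\<^sup>2 + 2 * L * (norm r)\<^sup>2)"
    using \<gamma> by (intro add_mono diff_mono mult_left_mono drift second) auto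
  also have "\<dots> = real CARD('n) * (norm (u - z))\<^sup>2 + 2 * \<gamma>\<^sup>2 * L * (norm r)\<^sup>2
      + (- 2 * \<gamma> * (1 - \<gamma> * L) * (norm q)\<^sup>2 + 2 * \<gamma> * \<delta> * norm q)"
    by (simp add: power2_eq_square algebra_simps)
  also have "\<dots> \<le> real CARD('n) * (norm (u - z))\<^sup>2 + 2 * \<gamma>\<^sup>2 * L * (norm r)\<^sup>2
      + \<gamma> * \<delta>\<^sup>2 / (2 * (1 - \<gamma> * L))"
    using square by simp
  finally show ?thesis by (simp add: v_def r_def)
qed

text \<open>Here the residual at \<open>x\<close> itself dominates the noise, so \<delta> is
  replaced by the residual over \<tau> at once and the noise only reduces the factor
  \<open>2 * \<gamma>\<close>.\<close>

lemma full_gradient_step: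
  fixes A :: "'n::finite \<Rightarrow> 'x::{real_inner, complete_space} \<Rightarrow> 'y::real_inner"
  assumes A: "\<And>i. bounded_linear (A i)"
    and yd: "norm (yd - stacked A z) \<le> \<delta>"
    and \<gamma>: "0 < \<gamma>" and \<tau>: "\<tau> > 0" "\<tau> * \<delta> \<le> norm (stacked A x - yd)"
  shows "(norm (x - \<gamma> *\<^sub>R full_grad A yd x - z))\<^sup>2 \<le> (norm (x - z))\<^sup>2
      - (2 * \<gamma> - 2 * \<gamma> / \<tau> - \<gamma>\<^sup>2 * (onorm (stacked A))\<^sup>2) * (norm (stacked A x - yd))\<^sup>2"
proof -
  note S = bounded_linear_stacked[of A, OF A]
  define r where "r = stacked A x - yd"
  define g where "g = full_grad A yd x"
  have g: "g = adjoint (stacked A) r" by (simp add: g_def full_grad_def r_def)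
  have \<delta>: "\<delta> \<le> norm r / \<tau>" using \<tau> by (simp add: r_def field_simps)
  have "- (r \<bullet> (yd - stacked A z)) \<le> norm r * norm (yd - stacked A z)"
    using Cauchy_Schwarz_ineq2[of r "yd - stacked A z"] by linarith
  also have "\<dots> \<le> norm r * (norm r / \<tau>)" using yd \<delta> by (intro mult_left_mono) auto
  finally have cross: "- (r \<bullet> (yd - stacked A z)) \<le> (norm r)\<^sup>2 / \<tau>"
    by (simp add: power2_eq_square)
  have "g \<bullet> (x - z) = r \<bullet> stacked A (x - z)"
    using inner_adjoint[OF S, of "x - z" r] by (simp add: g inner_commute)
  also have "stacked A (x - z) = r + (yd - stacked A z)"
    by (simp add: r_def linear_diff[OF bounded_linear.linear[OF S]])
  finally have drift: "(norm r)\<^sup>2 - (norm r)\<^sup>2 / \<tau> \<le> g \<bullet> (x - z)"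
    using cross by (simp add: inner_add_right power2_norm_eq_inner)
  have second: "(norm g)\<^sup>2 \<le> (onorm (stacked A))\<^sup>2 * (norm r)\<^sup>2"
    unfolding g by (rule norm_adjoint_square_le[OF S order_refl])
  have "(norm (x - \<gamma> *\<^sub>R g - z))\<^sup>2
      = (norm (x - z))\<^sup>2 - 2 * \<gamma> * (g \<bullet> (x - z)) + \<gamma>\<^sup>2 * (norm g)\<^sup>2"
    by (rule norm_diff_scaled_square)
  also have "\<dots> \<le> (norm (x - z))\<^sup>2 - 2 * \<gamma> * ((norm r)\<^sup>2 - (norm r)\<^sup>2 / \<tau>)
      + \<gamma>\<^sup>2 * ((onorm (stacked A))\<^sup>2 * (norm r)\<^sup>2)"
    using \<gamma> by (intro add_mono diff_mono mult_left_mono drift second) auto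
  finally show ?thesis by (simp add: g_def r_def algebra_simps)
qed

section \<open>Finite histories of indices and averaging over a fresh index\<close>

text \<open>Causality of the iteration: it lets an iterate be written later as a function of the
  indices drawn before it.\<close>

lemma svrg_inner_cong:
  assumes "\<And>l. l < k \<Longrightarrow> j l = j' l"
  shows "svrg_inner A yd \<tau> \<delta> \<gamma>0 \<gamma>1 x j k = svrg_inner A yd \<tau> \<delta> \<gamma>0 \<gamma>1 x j' k"
  using assms by (induction k) auto

lemma svrg_cong:
  assumes "\<And>p l. p < n \<Longrightarrow> l < m \<Longrightarrow> j p l = j' p l"
  shows "svrg A yd \<tau> \<delta> \<gamma>0 \<gamma>1 m x0 j n = svrg A yd \<tau> \<delta> \<gamma>0 \<gamma>1 m x0 j' n"
  using assms
proof (induction n)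
  case (Suc n)
  then have "svrg A yd \<tau> \<delta> \<gamma>0 \<gamma>1 m x0 j n = svrg A yd \<tau> \<delta> \<gamma>0 \<gamma>1 m x0 j' n" by simp
  moreover have "svrg_inner A yd \<tau> \<delta> \<gamma>0 \<gamma>1 x (j n) m = svrg_inner A yd \<tau> \<delta> \<gamma>0 \<gamma>1 x (j' n) m" for x
    using Suc.prems by (intro svrg_inner_cong) simp
  ultimately show ?case by simp
qed simp

context prob_space
begin

text \<open>A history over a finite \<open>J\<close> takes finitely many values in a discrete space,
  so every \<open>g\<close> is measurable and bounded on it. Thus no measurability of maps on the
  Hilbert space has to be shown.\<close>

lemma integrable_finite_history:
  fixes X :: "'t \<Rightarrow> 'a \<Rightarrow> 'n::finite" and g :: "('t \<Rightarrow> 'n) \<Rightarrow> real"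
  assumes X: "\<And>i. i \<in> J \<Longrightarrow> random_variable (count_space UNIV) (X i)" and J: "finite J"
  shows "integrable M (\<lambda>\<omega>. g (restrict (\<lambda>i. X i \<omega>) J))"
proof -
  have "(\<lambda>\<omega>. restrict (\<lambda>i. X i \<omega>) J) \<in> measurable M (PiM J (\<lambda>_. count_space UNIV))"
    using X by (intro measurable_restrict) auto
  then have "(\<lambda>\<omega>. restrict (\<lambda>i. X i \<omega>) J) \<in> measurable M (count_space (J \<rightarrow>\<^sub>E UNIV))"
    using count_space_PiM_finite[OF J, of "\<lambda>_. UNIV :: 'n set"] by (simp add: countable_finite)
  then have meas: "(\<lambda>\<omega>. g (restrict (\<lambda>i. X i \<omega>) J)) \<in> borel_measurable M"
    by (rule measurable_compose) simp
  have fin: "finite (J \<rightarrow>\<^sub>E (UNIV :: 'n set))" using J by (intro finite_PiE) auto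
  show "integrable M (\<lambda>\<omega>. g (restrict (\<lambda>i. X i \<omega>) J))"
    by (rule integrable_const_bound[where B = "Max ((\<lambda>h. \<bar>g h\<bar>) ` (J \<rightarrow>\<^sub>E UNIV))"])
      (auto intro!: meas AE_I2 Max_ge finite_imageI fin imageI)
qed

text \<open>This replaces conditioning on the history: \<open>F\<close> is split by the value of
  \<open>X t\<close>, and each summand is a product of an indicator and a function of the history,
  which are independent because \<open>t\<close> lies outside \<open>J\<close>.\<close>

lemma expectation_fresh_uniform_index:
  fixes X :: "'t \<Rightarrow> 'a \<Rightarrow> 'n::finite" and F :: "('t \<Rightarrow> 'n) \<Rightarrow> 'n \<Rightarrow> real"
  assumes indep: "indep_vars (\<lambda>_. count_space UNIV) X K"
    and J: "finite J" "J \<subseteq> K" and t: "t \<in> K" "t \<notin> J"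
    and unif: "distr M (count_space UNIV) (X t) = uniform_count_measure UNIV"
  shows "expectation (\<lambda>\<omega>. F (restrict (\<lambda>i. X i \<omega>) J) (X t \<omega>))
    = expectation (\<lambda>\<omega>. (\<Sum>i\<in>UNIV. F (restrict (\<lambda>i. X i \<omega>) J) i)) / real CARD('n)"
proof -
  let ?H = "\<lambda>\<omega>. restrict (\<lambda>i. X i \<omega>) J"
  have X: "random_variable (count_space UNIV) (X i)" if "i \<in> K" for i
    using indep that by (auto simp: indep_vars_def)
  have int_H: "integrable M (\<lambda>\<omega>. g (?H \<omega>))" for g :: "_ \<Rightarrow> real"
    using X J by (intro integrable_finite_history) auto
  have meas: "(\<lambda>\<omega>. indicat_real {i} (X t \<omega>)) \<in> borel_measurable M" for i
    by (rule measurable_compose[OF X[OF t(1)]]) simp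
  have int_X: "integrable M (\<lambda>\<omega>. indicat_real {i} (X t \<omega>))" for i
    by (rule integrable_const_bound[where B = 1]) (simp_all add: meas)
  have prob: "expectation (\<lambda>\<omega>. indicat_real {i} (X t \<omega>)) = 1 / real CARD('n)" for i
  proof -
    have "expectation (\<lambda>\<omega>. indicat_real {i} (X t \<omega>))
        = (\<integral>k. indicator {i} k \<partial>distr M (count_space UNIV) (X t))"
      using integral_distr[OF X[OF t(1)], of "indicat_real {i}"] by simp
    then show ?thesis
      by (simp add: unif measure_uniform_count_measure)
  qed
  have fresh: "indep_var borel (\<lambda>\<omega>. indicat_real {i} (X t \<omega>)) borel (\<lambda>\<omega>. F (?H \<omega>) i)" for i
  proof -
    have "indep_var (PiM {t} (\<lambda>_. count_space UNIV)) (\<lambda>\<omega>. restrict (\<lambda>i. X i \<omega>) {t})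
        (PiM J (\<lambda>_. count_space UNIV)) ?H"
      using J t by (intro indep_var_restrict[OF indep]) auto
    moreover have "(\<lambda>h. indicat_real {i} (h t))
        \<in> measurable (PiM {t} (\<lambda>_. count_space UNIV)) borel"
      by (rule measurable_compose[OF measurable_component_singleton]) auto
    moreover have "(\<lambda>h. F h i) \<in> measurable (PiM J (\<lambda>_. count_space UNIV)) borel"
      using count_space_PiM_finite[OF J(1), of "\<lambda>_. UNIV :: 'n set"]
      by (simp add: countable_finite)
    ultimately have "indep_var borel ((\<lambda>h. indicat_real {i} (h t)) \<circ> (\<lambda>\<omega>. restrict (\<lambda>i. X i \<omega>) {t}))
        borel ((\<lambda>h. F h i) \<circ> ?H)"
      by (rule indep_var_compose)
    then show ?thesis by (simp add: o_def)
  qed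
  have "expectation (\<lambda>\<omega>. F (?H \<omega>) (X t \<omega>))
      = expectation (\<lambda>\<omega>. \<Sum>i\<in>UNIV. indicator {i} (X t \<omega>) * F (?H \<omega>) i)"
    by (simp add: indicator_def sum.delta' if_distrib[of "\<lambda>c. c * _"] cong: if_cong)
  also have "\<dots> = (\<Sum>i\<in>UNIV. expectation (\<lambda>\<omega>. indicat_real {i} (X t \<omega>) * F (?H \<omega>) i))"
    by (intro Bochner_Integration.integral_sum indep_var_integrable[OF fresh int_X int_H])
  also have "\<dots> = (\<Sum>i\<in>UNIV. expectation (\<lambda>\<omega>. F (?H \<omega>) i) / real CARD('n))"
    unfolding indep_var_lebesgue_integral[OF fresh int_X int_H] prob by simp
  also have "\<dots> = expectation (\<lambda>\<omega>. \<Sum>i\<in>UNIV. F (?H \<omega>) i) / real CARD('n)"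
    by (subst Bochner_Integration.integral_sum) (auto intro: int_H simp: sum_divide_distrib)
  finally show ?thesis .
qed

end

section \<open>Descent in expectation and almost sure termination\<close>

theorem proposition5p1:
  fixes A :: "'n::finite \<Rightarrow> 'x::{real_inner, complete_space} \<Rightarrow> 'y::{real_inner, complete_space}"
    and Y :: "'n \<Rightarrow> 'y set"
    and y yd :: "'y ^ 'n"
    and x0 xdag :: 'x
    and \<delta> \<tau> \<gamma>0 \<gamma>1 L c1 :: real
    and m :: nat
    and M :: "'w measure"
    and ind :: "nat \<Rightarrow> nat \<Rightarrow> 'w \<Rightarrow> 'n"
    and x :: "nat \<Rightarrow> 'w \<Rightarrow> 'x"
  assumes Y: "\<And>i. subspace (Y i)" "\<And>i. closed (Y i)"
    and A: "\<And>i. bounded_linear (A i)" "\<And>i. range (A i) \<subseteq> Y i"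
    and L: "L = Max (range (\<lambda>i. (onorm (A i))\<^sup>2))"
    and y: "y \<in> range (stacked A)"
    and xdag: "is_arg_min (\<lambda>z. norm (z - x0)) (\<lambda>z. stacked A z = y) xdag"
    and yd: "\<And>i. yd $ i \<in> Y i" "norm (yd - y) \<le> \<delta>"
    and delta: "\<delta> > 0"
    and m: "m \<ge> 1"
    and M: "prob_space M"
    and indep: "prob_space.indep_vars M (\<lambda>_. count_space UNIV) (\<lambda>(n, k). ind n k) (UNIV \<times> {..<m})"
    and unif: "\<And>n k. k < m \<Longrightarrow>
      distr M (count_space UNIV) (ind n k) = uniform_count_measure UNIV"
    and x: "\<And>n \<omega>. x n \<omega> = svrg A yd \<tau> \<delta> \<gamma>0 \<gamma>1 m x0 (\<lambda>n k. ind n k \<omega>) n"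
    and tau: "\<tau> > 1"
    and gamma0: "\<gamma>0 > 0"
    and gamma1: "\<gamma>1 > 0" "L = 0 \<or> \<gamma>1 < 1 / L"
    and c1: "c1 = 2 * \<gamma>0 - 2 * \<gamma>0 / \<tau> - \<gamma>0\<^sup>2 * (onorm (stacked A))\<^sup>2
        - 2 * real m * \<gamma>1\<^sup>2 * L / real CARD('n)
        - real m * \<gamma>1 / (2 * real CARD('n) * (1 - \<gamma>1 * L) * \<tau>\<^sup>2)"
      "c1 > 0"
  shows "(\<forall>n. prob_space.expectation M (\<lambda>\<omega>. (norm (x (Suc n) \<omega> - xdag))\<^sup>2)
            \<le> prob_space.expectation M (\<lambda>\<omega>. (norm (x n \<omega> - xdag))\<^sup>2)
              - c1 * prob_space.expectation M
                  (\<lambda>\<omega>. discr_mu A yd \<tau> \<delta> (x n \<omega>) * (norm (stacked A (x n \<omega>) - yd))\<^sup>2))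
    \<and> (AE \<omega> in M. \<exists>n. norm (stacked A (x n \<omega>) - yd) \<le> \<tau> * \<delta>)"
proof -
  interpret prob_space M by fact
  define N where "N = real CARD('n)"
  have N: "N > 0" by (simp add: N_def)
  have norm_A: "(onorm (A i))\<^sup>2 \<le> L" for i unfolding L by (rule Max_ge) auto
  have "0 \<le> L" using norm_A order_trans zero_le_power2 by blast
  \<comment> \<open>The product form covers \<open>L = 0\<close> too, where \<open>1 / L\<close> is
    0 by convention.\<close>
  then have \<gamma>1: "0 < \<gamma>1" "\<gamma>1 * L < 1"
    using gamma1 by (cases "L = 0"; simp add: field_simps)+
  have xdag: "stacked A xdag = y" using xdag by (simp add: is_arg_min_def)
  have noise: "norm (yd - stacked A xdag) \<le> \<delta>" using yd(2) by (simp add: xdag)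

  define \<rho> where "\<rho> z = discr_mu A yd \<tau> \<delta> z * (norm (stacked A z - yd))\<^sup>2" for z
  define u where "u n k \<omega> = svrg_inner A yd \<tau> \<delta> \<gamma>0 \<gamma>1 (x n \<omega>) (\<lambda>k. ind n k \<omega>) k" for n k \<omega>
  \<comment> \<open>Per unit of \<open>\<rho>\<close>, \<open>b\<close> bounds the loss in one
    averaged inner step and \<open>a\<close> is the gain of the full gradient step; \<open>m\<close>
    inner steps leave \<open>c1\<close>.\<close>
  define b where "b = 2 * \<gamma>1\<^sup>2 * L / N + \<gamma>1 / (2 * N * (1 - \<gamma>1 * L) * \<tau>\<^sup>2)"
  define a where "a = 2 * \<gamma>0 - 2 * \<gamma>0 / \<tau> - \<gamma>0\<^sup>2 * (onorm (stacked A))\<^sup>2"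
  have c1_eq: "c1 = a - real m * b" by (simp add: c1(1) a_def b_def N_def algebra_simps)

  text \<open>While the discrepancy principle is not met, \<open>\<delta>\<close> is at most the residual divided by \<open>\<tau>\<close>.\<close>

  have step: "(\<Sum>i\<in>UNIV. (norm (v - (\<gamma>1 * discr_mu A yd \<tau> \<delta> z) *\<^sub>R (adjoint (A i) (A i (v - z))
        + (1 / real CARD('n)) *\<^sub>R full_grad A yd z) - xdag))\<^sup>2) / N
      \<le> (norm (v - xdag))\<^sup>2 + b * \<rho> z" for v z
  proof (cases "norm (stacked A z - yd) > \<tau> * \<delta>")
    case True
    let ?r = "norm (stacked A z - yd)"
    have "\<delta> \<le> ?r / \<tau>" using True tau by (simp add: field_simps)
    then have "\<delta>\<^sup>2 \<le> ?r\<^sup>2 / \<tau>\<^sup>2"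
      using power_mono[of \<delta> "?r / \<tau>" 2] delta by (simp add: power_divide)
    then have "\<gamma>1 * \<delta>\<^sup>2 / (2 * (1 - \<gamma>1 * L)) \<le> \<gamma>1 * (?r\<^sup>2 / \<tau>\<^sup>2) / (2 * (1 - \<gamma>1 * L))"
      using \<gamma>1 by (intro divide_right_mono mult_left_mono) auto
    then have "(\<Sum>i\<in>UNIV. (norm (v - \<gamma>1 *\<^sub>R (adjoint (A i) (A i (v - z))
        + (1 / real CARD('n)) *\<^sub>R full_grad A yd z) - xdag))\<^sup>2)
      \<le> N * (norm (v - xdag))\<^sup>2 + 2 * \<gamma>1\<^sup>2 * L * ?r\<^sup>2 + \<gamma>1 * (?r\<^sup>2 / \<tau>\<^sup>2) / (2 * (1 - \<gamma>1 * L))"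
      using svrg_inner_step_average[OF A(1) norm_A noise \<gamma>1, where u = v and x = z]
      unfolding N_def by linarith
    also have "\<dots> = ((norm (v - xdag))\<^sup>2 + b * ?r\<^sup>2) * N"
      using N by (simp add: b_def distrib_right)
    finally show ?thesis
      using True N by (simp add: pos_divide_le_eq \<rho>_def discr_mu_def)
  \<comment> \<open>After stopping, \<open>discr_mu\<close> is 0, the point does not move and both
    sides agree.\<close>
  qed (use N in \<open>simp add: discr_mu_def \<rho>_def N_def\<close>)

  have start: "(norm (u n 0 \<omega> - xdag))\<^sup>2 \<le> (norm (x n \<omega> - xdag))\<^sup>2 - a * \<rho> (x n \<omega>)" for n \<omega>
    using full_gradient_step[OF A(1) noise gamma0, where x = "x n \<omega>" and \<tau> = \<tau>] tau
    by (cases "norm (stacked A (x n \<omega>) - yd) > \<tau> * \<delta>")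
      (simp_all add: u_def \<rho>_def discr_mu_def a_def)

  define I where "I = (\<lambda>\<omega> (n, k). ind n k \<omega>)"
  \<comment> \<open>The draws made before inner step \<open>k\<close> of outer step
    \<open>n\<close>: all of the earlier outer steps and the first \<open>k\<close> of the current
    one. The pair \<open>(n, k)\<close> itself is left out, hence fresh.\<close>
  define J where "J n k = {..<n} \<times> {..<m} \<union> {n} \<times> {..<k}" for n k :: nat
  have J: "finite (J n k)" "k \<le> m \<Longrightarrow> J n k \<subseteq> UNIV \<times> {..<m}" for n k
    by (auto simp: J_def)
  have rv: "random_variable (count_space UNIV) (\<lambda>\<omega>. I \<omega> i)" if "i \<in> UNIV \<times> {..<m}" for i
    using indep that by (auto simp: indep_vars_def I_def)
  define xh where "xh n h = svrg A yd \<tau> \<delta> \<gamma>0 \<gamma>1 m x0 (\<lambda>n k. h (n, k)) n" for n h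
  define uh where "uh n k h = svrg_inner A yd \<tau> \<delta> \<gamma>0 \<gamma>1 (xh n h) (\<lambda>k. h (n, k)) k" for n k h
  \<comment> \<open>Stated for every \<open>k\<close>, so that the snapshot and the inner iterate
    are functions of the same history.\<close>
  have x_hist: "x n \<omega> = xh n (restrict (I \<omega>) (J n k))" for n k \<omega>
    unfolding x xh_def by (rule svrg_cong) (simp add: J_def I_def)
  have u_hist: "u n k \<omega> = uh n k (restrict (I \<omega>) (J n k))" for n k \<omega>
    unfolding u_def uh_def x_hist[of n \<omega> k] by (rule svrg_inner_cong) (simp add: J_def I_def)
  have int: "integrable M (\<lambda>\<omega>. g (restrict (I \<omega>) (J n k)))" if "k \<le> m"
    for n k and g :: "(nat \<times> nat \<Rightarrow> 'n) \<Rightarrow> real"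
    using J(1) by (rule integrable_finite_history[rotated]) (use rv J(2)[OF that] in blast)
  have int_x: "integrable M (\<lambda>\<omega>. g (x n \<omega>))" for n and g :: "'x \<Rightarrow> real"
    using int[of 0 "\<lambda>h. g (xh n h)" n] by (simp flip: x_hist)
  have int_u: "integrable M (\<lambda>\<omega>. g (u n k \<omega>))" if "k \<le> m" for n k and g :: "'x \<Rightarrow> real"
    using int[OF that, of "\<lambda>h. g (uh n k h)" n] by (simp flip: u_hist)

  have inner_step: "expectation (\<lambda>\<omega>. (norm (u n (Suc k) \<omega> - xdag))\<^sup>2)
      \<le> expectation (\<lambda>\<omega>. (norm (u n k \<omega> - xdag))\<^sup>2) + b * expectation (\<lambda>\<omega>. \<rho> (x n \<omega>))"
    if k: "k < m" for n k
  proof -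
    \<comment> \<open>The next squared error with the history \<open>h\<close> and the fresh index
      \<open>i\<close> as separate arguments.\<close>
    define F where "F h i = (norm (uh n k h - (\<gamma>1 * discr_mu A yd \<tau> \<delta> (xh n h)) *\<^sub>R
        (adjoint (A i) (A i (uh n k h - xh n h))
        + (1 / real CARD('n)) *\<^sub>R full_grad A yd (xh n h)) - xdag))\<^sup>2" for h i
    have "(norm (u n (Suc k) \<omega> - xdag))\<^sup>2 = F (restrict (I \<omega>) (J n k)) (I \<omega> (n, k))" for \<omega>
      unfolding F_def u_hist[symmetric] x_hist[symmetric] by (simp add: u_def I_def)
    then have "expectation (\<lambda>\<omega>. (norm (u n (Suc k) \<omega> - xdag))\<^sup>2)
        = expectation (\<lambda>\<omega>. F (restrict (I \<omega>) (J n k)) (I \<omega> (n, k)))" by simp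
    also have "\<dots> = expectation (\<lambda>\<omega>. \<Sum>i\<in>UNIV. F (restrict (I \<omega>) (J n k)) i) / N"
      unfolding N_def
    proof (rule expectation_fresh_uniform_index[of "\<lambda>i \<omega>. I \<omega> i" "UNIV \<times> {..<m}"])
      show "indep_vars (\<lambda>_. count_space UNIV) (\<lambda>i \<omega>. I \<omega> i) (UNIV \<times> {..<m})"
        using indep by (simp add: I_def case_prod_unfold)
      show "distr M (count_space UNIV) (\<lambda>\<omega>. I \<omega> (n, k)) = uniform_count_measure UNIV"
        using unif[OF k, of n] by (simp add: I_def)
    qed (use J[of k] k in \<open>auto simp: J_def\<close>)
    also have "\<dots> = expectation (\<lambda>\<omega>. (\<Sum>i\<in>UNIV. F (restrict (I \<omega>) (J n k)) i) / N)" by simp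
    also have "\<dots> \<le> expectation (\<lambda>\<omega>. (norm (u n k \<omega> - xdag))\<^sup>2 + b * \<rho> (x n \<omega>))"
    proof (rule integral_mono)
      show "integrable M (\<lambda>\<omega>. (\<Sum>i\<in>UNIV. F (restrict (I \<omega>) (J n k)) i) / N)"
        using k by (intro int[of k "\<lambda>h. (\<Sum>i\<in>UNIV. F h i) / N" n]) simp
      show "integrable M (\<lambda>\<omega>. (norm (u n k \<omega> - xdag))\<^sup>2 + b * \<rho> (x n \<omega>))"
        using k by (intro Bochner_Integration.integrable_add int_u[of _ "\<lambda>v. (norm (v - xdag))\<^sup>2"]
            int_x[of "\<lambda>z. b * \<rho> z"]) simp
      show "(\<Sum>i\<in>UNIV. F (restrict (I \<omega>) (J n k)) i) / N \<le> (norm (u n k \<omega> - xdag))\<^sup>2 + b * \<rho> (x n \<omega>)"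
        for \<omega>
        unfolding F_def u_hist[symmetric] x_hist[symmetric] by (rule step)
    qed
    also have "\<dots> = expectation (\<lambda>\<omega>. (norm (u n k \<omega> - xdag))\<^sup>2) + b * expectation (\<lambda>\<omega>. \<rho> (x n \<omega>))"
      using k int_u[of _ "\<lambda>v. (norm (v - xdag))\<^sup>2"] int_x[of "\<lambda>z. b * \<rho> z"] by simp
    finally show ?thesis .
  qed

  define E where "E n = expectation (\<lambda>\<omega>. (norm (x n \<omega> - xdag))\<^sup>2)" for n
  define R where "R n = expectation (\<lambda>\<omega>. \<rho> (x n \<omega>))" for n

  have descent: "E (Suc n) \<le> E n - c1 * R n" for n
  proof -
    \<comment> \<open>The snapshot is fixed during the inner loop, so each inner step costs the same
      \<open>b * R n\<close>; at \<open>k = m\<close> the inner iterate is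
      \<open>x (Suc n)\<close>.\<close>
    have "expectation (\<lambda>\<omega>. (norm (u n k \<omega> - xdag))\<^sup>2) \<le> E n - a * R n + real k * b * R n"
      if "k \<le> m" for k
      using that
    proof (induction k)
      case 0
      have "expectation (\<lambda>\<omega>. (norm (u n 0 \<omega> - xdag))\<^sup>2)
          \<le> expectation (\<lambda>\<omega>. (norm (x n \<omega> - xdag))\<^sup>2 - a * \<rho> (x n \<omega>))"
        by (intro integral_mono start int_u[of _ "\<lambda>v. (norm (v - xdag))\<^sup>2"]
            int_x[of "\<lambda>z. (norm (z - xdag))\<^sup>2 - a * \<rho> z"]) simp
      also have "\<dots> = E n - a * R n"
        unfolding E_def R_def
        using int_x[of "\<lambda>z. (norm (z - xdag))\<^sup>2"] int_x[of "\<lambda>z. a * \<rho> z"] by simp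
      finally show ?case by simp
    next
      case (Suc k)
      then show ?case using inner_step[of k n] by (simp add: R_def algebra_simps)
    qed
    from this[of m] show ?thesis
      by (simp add: E_def u_def x c1_eq algebra_simps)
  qed

  text \<open>The descent makes \<open>\<Sum>n. R n\<close> finite, whereas each \<open>R n\<close> is at least \<open>(\<tau> \<delta>)\<^sup>2\<close> times the
    probability of never stopping.\<close>

  define B where "B = {\<omega> \<in> space M. \<forall>n. \<tau> * \<delta> < norm (stacked A (x n \<omega>) - yd)}"
  \<comment> \<open>The residual norms are real functions of finite histories, hence measurable, and
    \<open>B\<close> is a countable intersection.\<close>
  have B: "B \<in> events"
    unfolding B_def
    using int_x[of "\<lambda>z. norm (stacked A z - yd)", THEN borel_measurable_integrable]
    by measurable
  have \<tau>\<delta>: "\<tau> * \<delta> > 0" using tau delta by simp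
  have "(\<tau> * \<delta>)\<^sup>2 * prob B \<le> R n" for n
  proof -
    have "(\<tau> * \<delta>)\<^sup>2 * prob B = expectation (\<lambda>\<omega>. (\<tau> * \<delta>)\<^sup>2 * indicator B \<omega>)"
      using B by simp
    also have "\<dots> \<le> R n"
      unfolding R_def
    proof (rule integral_mono)
      show "integrable M (\<lambda>\<omega>. (\<tau> * \<delta>)\<^sup>2 * indicator B \<omega> :: real)"
        using B
        by (intro integrable_mult_right integrable_real_indicator) (simp_all add: less_top[symmetric])
      \<comment> \<open>On \<open>B\<close> the method is still running and the residual exceeds
        \<open>\<tau> * \<delta>\<close>; off \<open>B\<close> it suffices that
        \<open>\<rho>\<close> is nonnegative.\<close>
      show "(\<tau> * \<delta>)\<^sup>2 * indicator B \<omega> \<le> \<rho> (x n \<omega>)" for \<omega>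
      proof (cases "\<omega> \<in> B")
        case True
        then show ?thesis
          using power_mono[of "\<tau> * \<delta>" "norm (stacked A (x n \<omega>) - yd)" 2] \<tau>\<delta>
          by (auto simp: B_def \<rho>_def discr_mu_def intro: less_imp_le)
      qed (simp add: \<rho>_def discr_mu_def)
    qed (rule int_x)
    finally show ?thesis .
  qed
  then have "c1 * ((\<tau> * \<delta>)\<^sup>2 * prob B) \<le> c1 * R n" for n
    using c1(2) by (intro mult_left_mono) auto
  then have E_step: "E (Suc n) \<le> E n - c1 * ((\<tau> * \<delta>)\<^sup>2 * prob B)" for n
    using descent[of n] order_trans[OF descent diff_left_mono] by blast
  \<comment> \<open>If \<open>prob B\<close> were positive, \<open>E\<close> would fall at least
    linearly in \<open>n\<close> and become negative, although it is an expected square.\<close>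
  have E_le: "E n \<le> E 0 - real n * (c1 * ((\<tau> * \<delta>)\<^sup>2 * prob B))" for n
  proof (induction n)
    case (Suc n)
    then show ?case using E_step[of n] by (simp add: algebra_simps)
  qed simp
  have "prob B = 0"
  proof (rule ccontr)
    assume "prob B \<noteq> 0"
    then have "0 < c1 * ((\<tau> * \<delta>)\<^sup>2 * prob B)"
      using c1(2) tau delta
      by (intro mult_pos_pos zero_less_power) (auto simp: zero_less_measure_iff)
    then obtain n where "E 0 < real n * (c1 * ((\<tau> * \<delta>)\<^sup>2 * prob B))"
      using reals_Archimedean3 by blast
    moreover have "0 \<le> E n" by (simp add: E_def)
    ultimately show False using E_le[of n] by simp
  qed
  then have "AE \<omega> in M. \<omega> \<notin> B"
    using B by (simp add: prob_eq_0)
  then have "AE \<omega> in M. \<exists>n. norm (stacked A (x n \<omega>) - yd) \<le> \<tau> * \<delta>"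
    by (rule AE_mp) (auto intro!: AE_I2 simp: B_def not_less)
  then show ?thesis using descent by (simp add: E_def R_def \<rho>_def)
qed

end
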